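(* Assume that the dynamics and the feedback operator satisfy the standing structural assumptions listed in the context (linear dissipation, $H$-dissipativity, nonlinearity assumption, feedback operator assumption). Let $\mu>0$ with $\mu c_0^2h^2<\nu$ and $\delta:=\frac{\nu\lambda_1}{2}+\frac{\mu}{2}-C_{\mathrm E}>0$. Suppose in addition that there is a constant $C_{\rm gl}\ge0$ such that $$-\langle N(z')-N(z),z'-z\rangle_H\le C_{\rm gl}\|z'-z\|_H^2\qquad\text{for all }z,z'\in\mathbb R^d,$$ and that $\mu>2C_{\rm gl}$. Let $(u_0,v_0)\in\mathbb R^d\times\mathbb R^d$ be arbitrary, let $u$ be the global solution of $\dot u+\nu Au+N(u)=f$, $u(0)=u_0$, and let $v$ be the unique global strong solution of $$dv+\nu Av\,dt+N(v)\,dt=f\,dt-\mu(I_hv-I_hu)\,dt+\mu\Gamma_h\,dW_t,\qquad v(0)=v_0 .$$ Then, for every $t\ge0$, $$\mathbb E\|v(t)-u(t)\|_H^2\le e^{-(\mu-2C_{\rm gl})t}\|v_0-u_0\|_H^2+\frac{\mu^2\operatorname{Tr}(\Gamma_h\Gamma_h^\top)}{\mu-2C_{\rm gl}}\Bigl(1-e^{-(\mu-2C_{\rm gl})t}\Bigr).$$ Consequently, $$\limsup_{t\to\infty}\mathbb E\|v(t)-u(t)\|_H^2\le\frac{\mu^2\operatorname{Tr}(\Gamma_h\Gamma_h^\top)}{\mu-2C_{\rm gl}} .$$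
   Context: $H=\mathbb R^d$ with Euclidean inner product $\langle z,z'\rangle_H=z^\top z'$ and norm $\|\cdot\|_H$. $\nu>0$, $f\in\mathbb R^d$, $A\in\mathbb R^{d\times d}$, $N:\mathbb R^d\to\mathbb R^d$. Standing structural assumptions. - Linear dissipation: $A$ is symmetric positive definite; $\lambda_1>0$ is its smallest eigenvalue, and $\|z\|_V:=\sqrt{z^\top Az}$. - $H$-dissipativity: there are $\alpha>0$, $\beta\ge0$ with $\nu z^\top Az+\langle N(z),z\rangle_H\ge \alpha\|z\|_H^2-\beta$ for all $z\in\mathbb R^d$. - Nonlinearity: $N$ is locally Lipschitz; there is $C_{\mathrm E}\ge0$ with $\langle N(z),z\rangle_H\ge -C_{\mathrm E}\|z\|_H^2$ for all $z$; and for every $R>0$ there is $C_R\ge0$ with $-\langle N(z')-N(z),z'-z\rangle_H\le C_R\|z'-z\|_H^2$ whenever $\|z\|_H,\|z'\|_H\le R$. - Feedback operator: for each $h\in[0,1]$, $I_h:\mathbb R^d\to\mathbb R^d$ is linear and $\|z-I_hz\|_H\le c_0h\|z\|_V$ for all $z$, with $c_0>0$ independent of $z,h$. Here $h\in[0,1]$ is fixed. Noise: $I_h=R_h\circ O_h$ with linear observation map $O_h:\mathbb R^d\to\mathbb R^k$ and linear reconstruction map $R_h:\mathbb R^k\to\mathbb R^d$; $W$ is a standard $k$-dimensional Brownian motion on a filtered probability space; $\Sigma\in\mathbb R^{k\times k}$ is deterministic; $\Gamma_h:=R_h\Sigma\in\mathbb R^{d\times k}$. The stochastic equation is understood in the Itô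 sense; under the hypotheses it has a unique global adapted strong solution with continuous paths. *)

theory Defs
  imports "HOL-Probability.Probability"
begin

section \<open>Deterministic setting\<close>

definition eigenvalue :: "real^'n^'n \<Rightarrow> real \<Rightarrow> bool" where
  "eigenvalue A l \<longleftrightarrow> (\<exists>x. x \<noteq> 0 \<and> A *v x = l *\<^sub>R x)"

definition smallest_eigenvalue :: "real^'n^'n \<Rightarrow> real \<Rightarrow> bool" where
  "smallest_eigenvalue A l \<longleftrightarrow> eigenvalue A l \<and> (\<forall>l'. eigenvalue A l' \<longrightarrow> l \<le> l')"

definition sym_pos_def :: "real^'n^'n \<Rightarrow> bool" where
  "sym_pos_def A \<longleftrightarrow> transpose A = A \<and> (\<forall>z. z \<noteq> 0 \<longrightarrow> z \<bullet> (A *v z) > 0)"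

definition V_norm :: "real^'n^'n \<Rightarrow> real^'n \<Rightarrow> real" where
  "V_norm A z = sqrt (z \<bullet> (A *v z))"

definition linear_dissipation :: "real^'n^'n \<Rightarrow> real \<Rightarrow> bool" where
  "linear_dissipation A lam1 \<longleftrightarrow> sym_pos_def A \<and> smallest_eigenvalue A lam1 \<and> lam1 > 0"

definition H_dissipativity ::
  "real \<Rightarrow> real^'n^'n \<Rightarrow> (real^'n \<Rightarrow> real^'n) \<Rightarrow> real \<Rightarrow> real \<Rightarrow> bool" where
  "H_dissipativity \<nu> A N \<alpha> \<beta> \<longleftrightarrow> \<alpha> > 0 \<and> \<beta> \<ge> 0 \<and>
     (\<forall>z. \<nu> * (z \<bullet> (A *v z)) + N z \<bullet> z \<ge> \<alpha> * (norm z)\<^sup>2 - \<beta>)"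

text \<open>The library notion \<^const>\<open>local_lipschitz\<close> is for maps with an additional (time) parameter,
  on which \<open>N\<close> does not depend.\<close>

definition nonlinearity_assumption :: "(real^'n \<Rightarrow> real^'n) \<Rightarrow> real \<Rightarrow> bool" where
  "nonlinearity_assumption N CE \<longleftrightarrow>
     local_lipschitz (UNIV :: real set) UNIV (\<lambda>_. N) \<and>
     CE \<ge> 0 \<and> (\<forall>z. N z \<bullet> z \<ge> - CE * (norm z)\<^sup>2) \<and>
     (\<forall>R>0. \<exists>C\<ge>0. \<forall>z z'. norm z \<le> R \<and> norm z' \<le> R \<longrightarrow>
        - ((N z' - N z) \<bullet> (z' - z)) \<le> C * (norm (z' - z))\<^sup>2)"

definition feedback_operator ::
  "real^'n^'n \<Rightarrow> (real \<Rightarrow> real^'n \<Rightarrow> real^'n) \<Rightarrow> real \<Rightarrow> bool" where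
  "feedback_operator A I c0 \<longleftrightarrow> c0 > 0 \<and>
     (\<forall>h\<in>{0..1}. linear (I h) \<and> (\<forall>z. norm (z - I h z) \<le> c0 * h * V_norm A z))"

definition global_solution ::
  "real \<Rightarrow> real^'n^'n \<Rightarrow> (real^'n \<Rightarrow> real^'n) \<Rightarrow> real^'n \<Rightarrow> real^'n \<Rightarrow> (real \<Rightarrow> real^'n) \<Rightarrow> bool" where
  "global_solution \<nu> A N f u0 u \<longleftrightarrow> u 0 = u0 \<and>
     (\<forall>t\<ge>0. (u has_vector_derivative (f - \<nu> *\<^sub>R (A *v u t) - N (u t))) (at t within {0..}))"

section \<open>Stochastic setting\<close>

text \<open>Time is \<open>[0, \<infinity>)\<close>. The filtration is indexed by all reals because the library locale
  \<^locale>\<open>filtration\<close> ranges over a whole type; its members at negative times play no role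
  (a filtration on \<open>[0, \<infinity>)\<close> extends by \<open>F t = F 0\<close> for \<open>t < 0\<close>).\<close>

definition filtered_prob_space :: "'w measure \<Rightarrow> (real \<Rightarrow> 'w measure) \<Rightarrow> bool" where
  "filtered_prob_space M F \<longleftrightarrow>
     prob_space M \<and> filtration (space M) F \<and> (\<forall>t. subalgebra M (F t))"

text \<open>The law \<open>N(0, (t - s) Id)\<close> of an increment is expressed through independent components
  that are centred Gaussian with variance \<open>t - s\<close>; the second parameter of
  \<^const>\<open>normal_density\<close> is the standard deviation.\<close>

definition std_brownian_motion ::
  "'w measure \<Rightarrow> (real \<Rightarrow> 'w measure) \<Rightarrow> (real \<Rightarrow> 'w \<Rightarrow> real^'k) \<Rightarrow> bool" where
  "std_brownian_motion M F W \<longleftrightarrow>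
     (\<forall>t\<ge>0. W t \<in> borel_measurable (F t)) \<and>
     (AE \<omega> in M. W 0 \<omega> = 0) \<and>
     (AE \<omega> in M. continuous_on {0..} (\<lambda>t. W t \<omega>)) \<and>
     (\<forall>s t. 0 \<le> s \<and> s < t \<longrightarrow>
        prob_space.indep_set M (sets (F s))
          {(\<lambda>\<omega>. W t \<omega> - W s \<omega>) -` B \<inter> space M | B. B \<in> sets borel} \<and>
        prob_space.indep_vars M (\<lambda>_. borel) (\<lambda>i \<omega>. (W t \<omega> - W s \<omega>) $ i) UNIV \<and>
        (\<forall>i. distributed M lborel (\<lambda>\<omega>. (W t \<omega> - W s \<omega>) $ i) (normal_density 0 (sqrt (t - s)))))"

text \<open>The Ito integral \<open>\<integral>\<^sub>0\<^sup>t G dW\<close> of a constant deterministic integrand. Such an integrand is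
  elementary, so this is the defining formula of the integral.\<close>

definition ito_integral_const :: "real^'k^'n \<Rightarrow> (real \<Rightarrow> 'w \<Rightarrow> real^'k) \<Rightarrow> real \<Rightarrow> 'w \<Rightarrow> real^'n" where
  "ito_integral_const G W t \<omega> = G *v (W t \<omega> - W 0 \<omega>)"

text \<open>Global strong solution of
  \<open>dv + \<nu> A v dt + N(v) dt = f dt - \<mu> (Ih v - Ih u) dt + \<mu> \<Gamma> dW\<close>, \<open>v(0) = v0\<close>, in integrated form;
  the equation at \<open>t = 0\<close> is the initial condition. The drift is continuous in time
  along almost every path when \<open>N\<close>, \<open>Ih\<close> and \<open>u\<close> are continuous, so its integral exists.\<close>

definition strong_solution ::
  "'w measure \<Rightarrow> (real \<Rightarrow> 'w measure) \<Rightarrow> (real \<Rightarrow> 'w \<Rightarrow> real^'k) \<Rightarrow> real \<Rightarrow> real^'n^'n \<Rightarrow>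
   (real^'n \<Rightarrow> real^'n) \<Rightarrow> real^'n \<Rightarrow> real \<Rightarrow> (real^'n \<Rightarrow> real^'n) \<Rightarrow> real^'k^'n \<Rightarrow>
   (real \<Rightarrow> real^'n) \<Rightarrow> real^'n \<Rightarrow> (real \<Rightarrow> 'w \<Rightarrow> real^'n) \<Rightarrow> bool" where
  "strong_solution M F W \<nu> A N f \<mu> Ih \<Gamma> u v0 v \<longleftrightarrow>
     (\<forall>t\<ge>0. v t \<in> borel_measurable (F t)) \<and>
     (AE \<omega> in M. continuous_on {0..} (\<lambda>t. v t \<omega>)) \<and>
     (AE \<omega> in M. \<forall>t\<ge>0.
        v t \<omega> = v0
          + integral {0..t} (\<lambda>s. f - \<nu> *\<^sub>R (A *v v s \<omega>) - N (v s \<omega>) - \<mu> *\<^sub>R (Ih (v s \<omega>) - Ih (u s)))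
          + ito_integral_const (\<mu> *\<^sub>R \<Gamma>) W t \<omega>)"

end

theory Submission
  imports Defs "HOL-Real_Asymp.Real_Asymp"
begin

text \<open>The proof avoids the Ito formula, and with it stopping times and the integrability of a drift
  of arbitrary growth. Since the noise is additive, the difference \<open>w = v - u\<close> solves pathwise
  \<open>w(t) = w(0) + \<integral>\<^sub>0\<^sup>t b(s, w(s)) ds + G (W(t) - W(0))\<close> with \<open>b(s, 0) = 0\<close> and
  \<open>2 (b(s, x) - b(s, y)) \<bullet> (x - y) \<le> - \<kappa> |x - y|\<^sup>2\<close>, where \<open>\<kappa> = \<mu> - 2 C\<^sub>g\<^sub>l\<close>. An implicit Euler step
  \<open>X' - D b(X') = X + \<Delta>\<close> therefore gives \<open>(1 + \<kappa> D) |X'|\<^sup>2 \<le> |X + \<Delta>|\<^sup>2\<close>, and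
  orthogonality of \<open>X\<close> and \<open>\<Delta>\<close> turns this into the desired bound, with
  \<open>(1 + \<kappa> t / n)\<^sup>-\<^sup>n\<close> in place of the exponential. By dissipativity the scheme is non-expansive, so along
  each continuous path its error is at most \<open>t\<close> times the modulus of continuity of \<open>s \<mapsto> b(s, w(s))\<close>
  at \<open>t / n\<close>; Fatou's lemma passes to the limit.\<close>

section \<open>Resolvents of dissipative maps\<close>

text \<open>Expansiveness gives injectivity, so invariance of domain makes the range open. It also
  makes preimages of Cauchy sequences Cauchy, so the range is closed, and connectedness of the space
  finishes. This yields solvability of every implicit Euler step.\<close>

lemma surj_if_expansive:
  fixes T :: "'a::euclidean_space \<Rightarrow> 'a"
  assumes cont: "continuous_on UNIV T"
    and exp: "\<And>x y. norm (x - y) \<le> norm (T x - T y)"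
  shows "surj T"
proof -
  have inj: "inj T"
  proof (rule injI)
    fix x y assume "T x = T y"
    with exp[of x y] show "x = y" by simp
  qed
  have "open (range T)"
    using invariance_of_domain[OF cont open_UNIV inj] .
  moreover have "closed (range T)"
    unfolding closed_sequential_limits
  proof safe
    fix y l assume y: "\<forall>n. y n \<in> range T" and l: "y \<longlonglongrightarrow> l"
    have "\<forall>n. \<exists>a. y n = T a" using y by blast
    then obtain x where x: "\<And>n. y n = T (x n)" by metis
    have "Cauchy y" using l by (rule LIMSEQ_imp_Cauchy)
    have "Cauchy x"
    proof (rule CauchyI)
      fix e :: real assume "0 < e"
      with \<open>Cauchy y\<close> obtain K where "\<forall>m\<ge>K. \<forall>n\<ge>K. norm (y m - y n) < e"
        by (blast dest: CauchyD)
      then show "\<exists>K. \<forall>m\<ge>K. \<forall>n\<ge>K. norm (x m - x n) < e"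
        unfolding x using exp order_le_less_trans by blast
    qed
    then obtain a where a: "x \<longlonglongrightarrow> a" using Cauchy_convergent[of x] unfolding convergent_def by auto
    have "isCont T a" using cont by (rule continuous_on_interior) simp
    then have "(\<lambda>n. T (x n)) \<longlonglongrightarrow> T a" using a by (rule isCont_tendsto_compose)
    with l have "l = T a" unfolding x[symmetric] by (rule LIMSEQ_unique)
    then show "l \<in> range T" by simp
  qed
  ultimately show ?thesis
    by (metis UNIV_not_empty clopen image_is_empty)
qed

text \<open>Pair the difference of the images with \<open>x - y\<close>: dissipativity contributes a
  nonnegative term, and Cauchy-Schwarz does the rest. Read backwards, the resolvent is 1-Lipschitz
  for every step size \<open>D\<close>; solvability, measurability and stability of the scheme all
  rest on this.\<close>

lemma norm_le_resolvent_diff: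
  fixes B :: "'a::real_inner \<Rightarrow> 'a"
  assumes diss: "(B x - B y) \<bullet> (x - y) \<le> 0" and "0 \<le> D"
  shows "norm (x - y) \<le> norm ((x - D *\<^sub>R B x) - (y - D *\<^sub>R B y))"
proof -
  let ?z = "(x - D *\<^sub>R B x) - (y - D *\<^sub>R B y)"
  have "(norm (x - y))\<^sup>2 \<le> (norm (x - y))\<^sup>2 - D * ((B x - B y) \<bullet> (x - y))"
    using assms by (simp add: mult_nonneg_nonpos)
  also have "\<dots> = ?z \<bullet> (x - y)"
  proof -
    have "?z = (x - y) - D *\<^sub>R (B x - B y)" by (simp add: algebra_simps)
    then show ?thesis
      by (simp only: inner_diff_left[of "x - y" "D *\<^sub>R (B x - B y)"] inner_scaleR_left power2_norm_eq_inner)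
  qed
  also have "\<dots> \<le> norm ?z * norm (x - y)"
    by (rule norm_cauchy_schwarz)
  finally have "norm (x - y) * norm (x - y) \<le> norm ?z * norm (x - y)"
    by (simp only: power2_eq_square)
  then show ?thesis
    by (cases "x = y") (simp_all add: mult_le_cancel_right)
qed

lemma surj_resolvent:
  fixes B :: "'a::euclidean_space \<Rightarrow> 'a"
  assumes "continuous_on UNIV B" and "\<And>x y. (B x - B y) \<bullet> (x - y) \<le> 0" and "0 \<le> D"
  shows "surj (\<lambda>x. x - D *\<^sub>R B x)"
  by (intro surj_if_expansive continuous_intros norm_le_resolvent_diff assms)

text \<open>Expand the square: the cross term supplies \<open>\<kappa> * D\<close>, and the term
  quadratic in \<open>D\<close> has a favourable sign. This is the source of the decay in each
  step.\<close>

lemma resolvent_norm_sq_le: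
  fixes B :: "'a::real_inner \<Rightarrow> 'a"
  assumes "2 * (B x \<bullet> x) \<le> - \<kappa> * (norm x)\<^sup>2" and "0 \<le> D"
  shows "(1 + \<kappa> * D) * (norm x)\<^sup>2 \<le> (norm (x - D *\<^sub>R B x))\<^sup>2"
proof -
  have "D * (2 * (B x \<bullet> x)) \<le> D * (- \<kappa> * (norm x)\<^sup>2)"
    using assms by (intro mult_left_mono)
  moreover have "0 \<le> D\<^sup>2 * (norm (B x))\<^sup>2" by simp
  moreover have "(norm (x - D *\<^sub>R B x))\<^sup>2 = (norm x)\<^sup>2 - D * (2 * (B x \<bullet> x)) + D\<^sup>2 * (norm (B x))\<^sup>2"
    unfolding power2_norm_eq_inner
    by (simp add: power2_eq_square inner_diff inner_commute[of "B x" x] algebra_simps)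
  moreover have "(1 + \<kappa> * D) * (norm x)\<^sup>2 = (norm x)\<^sup>2 - D * (- \<kappa> * (norm x)\<^sup>2)"
    by (simp add: algebra_simps)
  ultimately show ?thesis by linarith
qed

section \<open>Pathwise convergence of the implicit Euler scheme\<close>

text \<open>The right endpoint appears because an implicit scheme evaluates the drift at the end of
  the step; this bounds its local error.\<close>

lemma integral_endpoint_error:
  fixes \<phi> :: "real \<Rightarrow> 'a::banach"
  assumes "a \<le> b" and cont: "continuous_on {a..b} \<phi>"
    and e: "\<And>s. s \<in> {a..b} \<Longrightarrow> norm (\<phi> s - \<phi> b) \<le> e"
  shows "norm (integral {a..b} \<phi> - (b - a) *\<^sub>R \<phi> b) \<le> (b - a) * e"
proof -
  have "integral {a..b} (\<lambda>s. \<phi> s - \<phi> b) = integral {a..b} \<phi> - (b - a) *\<^sub>R \<phi> b"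
    using assms by (subst integral_diff) (auto intro: integrable_continuous_interval)
  moreover have "norm (integral {a..b} (\<lambda>s. \<phi> s - \<phi> b)) \<le> e * (b - a)"
    using assms by (intro integral_bound continuous_intros) auto
  ultimately show ?thesis by (simp add: mult.commute)
qed

text \<open>The path \<open>w\<close> satisfies the recursion of the scheme up to the endpoint
  quadrature error. The resolvent is non-expansive, so these local errors add up without
  amplification: dissipativity takes the place of a Lipschitz constant and a Gronwall
  factor.\<close>

lemma implicit_euler_tendsto:
  fixes b :: "real \<Rightarrow> 'a::euclidean_space \<Rightarrow> 'a" and w G :: "real \<Rightarrow> 'a"
    and x :: "nat \<Rightarrow> nat \<Rightarrow> 'a"
  assumes "0 \<le> T"
    and diss: "\<And>s x y. (b s x - b s y) \<bullet> (x - y) \<le> 0"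
    and cont: "continuous_on {0..T} (\<lambda>s. b s (w s))"
    and w: "\<And>t. t \<in> {0..T} \<Longrightarrow> w t = init + integral {0..t} (\<lambda>s. b s (w s)) + G t"
    and G0: "G 0 = 0"
    and x_init: "\<And>n. x n 0 = init"
    and step: "\<And>n i. x n (Suc i) - (T / n) *\<^sub>R b (real (Suc i) * (T / n)) (x n (Suc i))
                 = x n i + (G (real (Suc i) * (T / n)) - G (real i * (T / n)))"
  shows "(\<lambda>n. x n n) \<longlonglongrightarrow> w T"
proof (rule LIMSEQ_I)
  fix r :: real assume "0 < r"
  define \<phi> where "\<phi> s = b s (w s)" for s
  have w': "w t = init + integral {0..t} \<phi> + G t" if "t \<in> {0..T}" for t
    using w[OF that] unfolding \<phi>_def .
  have cont': "continuous_on {0..T} \<phi>" using cont unfolding \<phi>_def .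
  \<comment> \<open>The total error will be at most \<open>T * e\<close>; the denominator
    \<open>T + 1\<close> also covers \<open>T = 0\<close>.\<close>
  define e where "e = r / 2 / (T + 1)"
  have e: "0 < e" using \<open>0 \<le> T\<close> \<open>0 < r\<close> by (simp add: e_def)
  have "uniformly_continuous_on {0..T} \<phi>"
    using cont' compact_uniformly_continuous by blast
  then obtain d where d: "0 < d"
    and d': "\<And>s s'. s \<in> {0..T} \<Longrightarrow> s' \<in> {0..T} \<Longrightarrow> dist s' s < d \<Longrightarrow> dist (\<phi> s') (\<phi> s) < e"
    using e unfolding uniformly_continuous_on_def by metis
  \<comment> \<open>From \<open>n0\<close> on, the step \<open>T / n\<close> is shorter than
    \<open>d\<close>. Positivity of \<open>n0\<close> excludes \<open>n = 0\<close>, where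
    \<open>T / n\<close> is 0 by convention and \<open>n * D = T\<close> can fail.\<close>
  obtain n0 :: nat where n0: "T / d < n0" using reals_Archimedean2 by blast
  have n0pos: "n0 > 0"
    using n0 d \<open>0 \<le> T\<close> by (metis divide_nonneg_pos gr0I less_le_not_le of_nat_0)
  show "\<exists>no. \<forall>n\<ge>no. norm (x n n - w T) < r"
  proof (intro exI allI impI)
    fix n :: nat assume n: "n0 \<le> n"
    define D where "D = T / n"
    have npos: "n > 0" using n n0pos by simp
    have D0: "0 \<le> D" and nD: "n * D = T" using \<open>0 \<le> T\<close> npos by (auto simp: D_def)
    have "T < n * d" using n n0 d
      by (metis less_le_trans of_nat_le_iff pos_divide_less_eq)
    then have Dd: "D < d" using npos by (simp add: D_def field_simps)
    \<comment> \<open>Every step adds at most \<open>D * e\<close>, which at \<open>i = n\<close>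
      amounts to \<open>T * e\<close>.\<close>
    have "norm (x n i - w (i * D)) \<le> i * (D * e)" if "i \<le> n" for i
      using that
    proof (induction i)
      case 0
      have "w 0 = init" using w[of 0] G0 \<open>0 \<le> T\<close> by simp
      then show ?case by (simp add: x_init)
    next
      case (Suc i)
      let ?a = "i * D" and ?b = "Suc i * D"
      have ab: "0 \<le> ?a" "?a \<le> ?b" "?b \<le> T" "?b - ?a = D"
        using D0 Suc.prems nD
        by (auto simp: algebra_simps simp flip: nD)
           (metis D0 Suc.prems mult.commute mult_right_mono of_nat_Suc of_nat_le_iff
              distrib_left mult.right_neutral add.commute)
      have ab': "?a \<in> {0..T}" "?b \<in> {0..T}" using ab by auto
      have "integral {0..?a} \<phi> + integral {?a..?b} \<phi> = integral {0..?b} \<phi>"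
        using ab cont'
        by (intro Henstock_Kurzweil_Integration.integral_combine integrable_continuous_interval)
           (auto intro: continuous_on_subset)
      \<comment> \<open>The integral equation at two neighbouring grid points trades the forcing
        increment for an increment of \<open>w\<close> and a drift integral. Inserted into the step
        of the scheme, it leaves only the previous error and the quadrature error.\<close>
      then have Gw: "G ?b - G ?a = w ?b - w ?a - integral {?a..?b} \<phi>"
        using w'[OF ab'(1)] w'[OF ab'(2)] by (simp add: algebra_simps)
      have err: "norm (integral {?a..?b} \<phi> - (?b - ?a) *\<^sub>R \<phi> ?b) \<le> (?b - ?a) * e"
      proof (rule integral_endpoint_error)
        show "?a \<le> ?b" by fact
        show "continuous_on {?a..?b} \<phi>"
          by (rule continuous_on_subset[OF cont'])
             (use ab(1,3) in \<open>simp only: atLeastatMost_subset_iff simp_thms\<close>)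
        fix s assume s: "s \<in> {?a..?b}"
        then have "dist s ?b < d" using Dd ab by (auto simp: dist_real_def)
        moreover have "s \<in> {0..T}" using s ab(1,3) by (meson atLeastAtMost_iff order_trans)
        ultimately show "norm (\<phi> s - \<phi> ?b) \<le> e"
          using d'[OF ab'(2), of s] unfolding dist_norm by (simp only: less_imp_le)
      qed
      have st: "x n (Suc i) - D *\<^sub>R b ?b (x n (Suc i)) = x n i + (G ?b - G ?a)"
        using step[of n i] by (simp only: D_def)
      have "norm (x n (Suc i) - w ?b)
          \<le> norm ((x n (Suc i) - D *\<^sub>R b ?b (x n (Suc i))) - (w ?b - D *\<^sub>R b ?b (w ?b)))"
        by (intro norm_le_resolvent_diff diss D0)
      also have "(x n (Suc i) - D *\<^sub>R b ?b (x n (Suc i))) - (w ?b - D *\<^sub>R b ?b (w ?b))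
          = (x n i - w ?a) - (integral {?a..?b} \<phi> - (?b - ?a) *\<^sub>R \<phi> ?b)"
        unfolding st Gw ab(4) \<phi>_def by (simp add: algebra_simps)
      also have "norm \<dots> \<le> norm (x n i - w ?a) + (?b - ?a) * e"
        using err norm_triangle_ineq4 by (meson add_left_mono order_trans)
      also have "\<dots> \<le> Suc i * (D * e)"
        using Suc by (simp add: algebra_simps)
      finally show ?case .
    qed
    from this[of n] have "norm (x n n - w T) \<le> T * e"
      by (simp only: mult.assoc[symmetric] nD)
    also have "\<dots> \<le> (T + 1) * e"
      using e by (simp add: distrib_right)
    also have "\<dots> = r / 2"
    proof -
      have "T + 1 \<noteq> 0" using \<open>0 \<le> T\<close> by simp
      then show ?thesis by (metis e_def mult.commute nonzero_eq_divide_eq)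
    qed
    also have "\<dots> < r"
      using \<open>0 < r\<close> by simp
    finally show "norm (x n n - w T) < r" .
  qed
qed

text \<open>A discrete Gronwall inequality: \<open>S / \<kappa>\<close> is the fixed point of the
  recursion, and the excess over it obeys the recursion without the \<open>S\<close> term.\<close>

lemma affine_recursion_le:
  fixes a :: "nat \<Rightarrow> real"
  assumes "0 < \<kappa>" "0 \<le> D" and rec: "\<And>i. (1 + \<kappa> * D) * a (Suc i) \<le> a i + S * D"
  shows "a n \<le> (a 0 - S / \<kappa>) / (1 + \<kappa> * D) ^ n + S / \<kappa>"
proof (induction n)
  case (Suc n)
  have p: "0 < 1 + \<kappa> * D" using assms by (simp add: add_pos_nonneg)
  have "(1 + \<kappa> * D) * (a (Suc n) - S / \<kappa>) = (1 + \<kappa> * D) * a (Suc n) - S / \<kappa> - S * D"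
    using assms by (simp add: field_simps)
  also have "\<dots> \<le> a n - S / \<kappa>" using rec[of n] by simp
  also have "\<dots> \<le> (a 0 - S / \<kappa>) / (1 + \<kappa> * D) ^ n" using Suc by simp
  finally have "a (Suc n) - S / \<kappa> \<le> (a 0 - S / \<kappa>) / (1 + \<kappa> * D) ^ n / (1 + \<kappa> * D)"
    by (simp only: pos_le_divide_eq[OF p] mult.commute[of _ "1 + \<kappa> * D"])
  also have "\<dots> = (a 0 - S / \<kappa>) / (1 + \<kappa> * D) ^ Suc n"
    by (simp only: power_Suc2 divide_divide_eq_left)
  finally show ?case by linarith
qed simp

section \<open>Moments and independence of Brownian increments\<close>

context
  fixes M :: "'w measure" and F :: "real \<Rightarrow> 'w measure" and W :: "real \<Rightarrow> 'w \<Rightarrow> real^'k"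
    and s t :: real
  assumes filt: "filtered_prob_space M F" and bm: "std_brownian_motion M F W"
    and st: "0 \<le> s" "s < t"
begin

interpretation prob_space M
  using filt by (simp add: filtered_prob_space_def)

lemma brownian_increment_distributed:
  "distributed M lborel (\<lambda>\<omega>. (W t \<omega> - W s \<omega>) $ i) (normal_density 0 (sqrt (t - s)))"
  using bm st unfolding std_brownian_motion_def by blast

lemma brownian_increment_integrable:
  "integrable M (\<lambda>\<omega>. (W t \<omega> - W s \<omega>) $ i)"
  "integrable M (\<lambda>\<omega>. ((W t \<omega> - W s \<omega>) $ i)\<^sup>2)"
proof -
  have pos: "0 < sqrt (t - s)" using st by simp
  have "integrable lborel (\<lambda>x. normal_density 0 (sqrt (t - s)) x * x)"
    using normal_moment_nz_1[OF pos, of 0] by (simp add: has_bochner_integral_iff)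
  then show "integrable M (\<lambda>\<omega>. (W t \<omega> - W s \<omega>) $ i)"
    by (rule distributed_integrable_var[OF brownian_increment_distributed normal_density_nonneg])
  have "integrable lborel (\<lambda>x. normal_density 0 (sqrt (t - s)) x * x\<^sup>2)"
    using normal_moment_even[OF pos, of 0 1] by (simp add: has_bochner_integral_iff)
  then show "integrable M (\<lambda>\<omega>. ((W t \<omega> - W s \<omega>) $ i)\<^sup>2)"
    by (subst (asm) distributed_integrable[OF brownian_increment_distributed]) auto
qed

lemma brownian_increment_expectation:
  "expectation (\<lambda>\<omega>. (W t \<omega> - W s \<omega>) $ i) = 0"
  using st by (intro normal_distributed_expectation[OF _ brownian_increment_distributed]) simp

lemma brownian_increment_covariance:
  "has_bochner_integral M (\<lambda>\<omega>. (W t \<omega> - W s \<omega>) $ i * (W t \<omega> - W s \<omega>) $ j)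
     (if i = j then t - s else 0)"
proof (cases "i = j")
  case True
  have "variance (\<lambda>\<omega>. (W t \<omega> - W s \<omega>) $ i) = (sqrt (t - s))\<^sup>2"
    using st by (intro normal_distributed_variance[OF _ brownian_increment_distributed]) simp
  then show ?thesis
    using True st brownian_increment_integrable(2)[of i] brownian_increment_expectation[of i]
    by (simp add: has_bochner_integral_iff power2_eq_square)
next
  case False
  \<comment> \<open>On the index set \<open>{i, j}\<close> the product rule for independent families
    becomes the rule for two components, since \<open>i \<noteq> j\<close>.\<close>
  have ind: "indep_vars (\<lambda>_. borel) (\<lambda>i \<omega>. (W t \<omega> - W s \<omega>) $ i) {i, j}"
    using bm st unfolding std_brownian_motion_def
    by (blast intro: indep_vars_subset[OF _ subset_UNIV])
  show ?thesis
    using indep_vars_lebesgue_integral[OF _ ind] indep_vars_integrable[OF _ ind] False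
      brownian_increment_integrable(1) brownian_increment_expectation
    by (simp add: has_bochner_integral_iff)
qed

text \<open>The Ito isometry for a constant integrand. Expanding the square in components, the
  covariance keeps only the terms with \<open>i = j\<close>, which sum to the squared entries of
  \<open>G\<close>.\<close>

lemma brownian_increment_matrix_norm_sq:
  fixes G :: "real^'k^'n"
  shows "has_bochner_integral M (\<lambda>\<omega>. (norm (G *v (W t \<omega> - W s \<omega>)))\<^sup>2)
           ((t - s) * trace (G ** transpose G))"
proof -
  have "has_bochner_integral M
      (\<lambda>\<omega>. \<Sum>a\<in>UNIV. \<Sum>i\<in>UNIV. \<Sum>j\<in>UNIV.
         (G $ a $ i * G $ a $ j) * ((W t \<omega> - W s \<omega>) $ i * (W t \<omega> - W s \<omega>) $ j))
      (\<Sum>a\<in>UNIV. \<Sum>i\<in>UNIV. \<Sum>j\<in>UNIV.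
         (G $ a $ i * G $ a $ j) * (if i = j then t - s else 0))"
    by (intro has_bochner_integral_sum has_bochner_integral_mult_right brownian_increment_covariance)
  also have "(\<Sum>a\<in>UNIV. \<Sum>i\<in>UNIV. \<Sum>j\<in>UNIV.
         (G $ a $ i * G $ a $ j) * (if i = j then t - s else 0)) = (t - s) * trace (G ** transpose G)"
    by (simp add: trace_def matrix_matrix_mult_def transpose_def sum_distrib_left
        if_distrib[of "(*) _"] mult_ac cong: if_cong)
  also have "(\<lambda>\<omega>. \<Sum>a\<in>UNIV. \<Sum>i\<in>UNIV. \<Sum>j\<in>UNIV.
         (G $ a $ i * G $ a $ j) * ((W t \<omega> - W s \<omega>) $ i * (W t \<omega> - W s \<omega>) $ j))
      = (\<lambda>\<omega>. (norm (G *v (W t \<omega> - W s \<omega>)))\<^sup>2)"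
    by (simp only: power2_norm_eq_inner inner_vec_def matrix_vector_mult_def vec_lambda_beta
        sum_product inner_real_def mult_ac)
  finally show ?thesis .
qed

text \<open>Independence of the whole increment from \<open>F s\<close> descends to smaller
  families: events of \<open>X\<close> lie in \<open>F s\<close>, and events of one component are
  events of the increment.\<close>

lemma brownian_increment_indep:
  fixes X :: "'w \<Rightarrow> real"
  assumes X: "X \<in> borel_measurable (F s)"
  shows "indep_var borel X borel (\<lambda>\<omega>. (W t \<omega> - W s \<omega>) $ i)"
proof -
  have sub: "space (F s) = space M" "sets (F s) \<subseteq> sets M"
    using filt by (auto simp: filtered_prob_space_def subalgebra_def)
  let ?Y = "\<lambda>\<omega>. W t \<omega> - W s \<omega>"
  let ?P = "{?Y -` B \<inter> space M | B. B \<in> sets borel}"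
  have ind: "indep_set (sets (F s)) ?P"
    using bm st unfolding std_brownian_motion_def by blast
  have X': "{X -` A \<inter> space M | A. A \<in> sets borel} \<subseteq> sets (F s)"
    using measurable_sets[OF X] by (auto simp: sub)
  have Y': "{(\<lambda>\<omega>. ?Y \<omega> $ i) -` A \<inter> space M | A. A \<in> sets borel} \<subseteq> ?P"
  proof safe
    fix A :: "real set" assume "A \<in> sets borel"
    then have "(\<lambda>x::real^'k. x $ i) -` A \<inter> space borel \<in> sets borel"
      by (intro measurable_sets[of _ borel borel]) auto
    then show "\<exists>B. (\<lambda>\<omega>. ?Y \<omega> $ i) -` A \<inter> space M = ?Y -` B \<inter> space M \<and> B \<in> sets borel"
      by (intro exI[of _ "(\<lambda>x::real^'k. x $ i) -` A \<inter> space borel"]) auto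
  qed
  have Xm: "random_variable borel X"
    using X sub by (intro measurable_from_subalg[of M "F s"]) (auto simp: subalgebra_def)
  have Ym: "random_variable borel (\<lambda>\<omega>. ?Y \<omega> $ i)"
    using borel_measurable_integrable[OF brownian_increment_integrable(1)] .
  \<comment> \<open>Both \<open>indep_set\<close> and \<open>indep_var\<close> are independence of
    families indexed by the booleans, so it suffices to shrink the two families of events.\<close>
  have "indep_sets (\<lambda>b. {(case b of True \<Rightarrow> X | False \<Rightarrow> \<lambda>\<omega>. ?Y \<omega> $ i) -` A \<inter> space M | A. A \<in> sets (case b of True \<Rightarrow> borel | False \<Rightarrow> borel)}) UNIV"
    by (rule indep_sets_mono_sets[OF ind[unfolded indep_set_def]])
       (use X' Y' in \<open>auto split: bool.split\<close>)
  then show ?thesis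
    unfolding indep_var_def indep_vars_def2 using Xm Ym by (auto split: bool.split)
qed

text \<open>In components, independence factorises the expectation and the increment has mean zero.
  Square integrability of \<open>X\<close> makes its components integrable, the measure being
  finite. This removes the cross term when a noise increment is added to the state.\<close>

lemma brownian_increment_orthogonal:
  fixes G :: "real^'k^'n" and X :: "'w \<Rightarrow> real^'n"
  assumes X: "X \<in> borel_measurable (F s)" and int: "integrable M (\<lambda>\<omega>. (norm (X \<omega>))\<^sup>2)"
  shows "has_bochner_integral M (\<lambda>\<omega>. X \<omega> \<bullet> (G *v (W t \<omega> - W s \<omega>))) 0"
proof -
  have Xm [measurable]: "X \<in> borel_measurable M"
    using X filt by (auto simp: filtered_prob_space_def intro: measurable_from_subalg[of M "F s"])
  have nth: "(\<lambda>x::real^'n. x $ a) \<in> borel_measurable borel" for a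
    by (intro borel_measurable_continuous_onI continuous_intros)
  note Xa [measurable] = measurable_compose[OF Xm nth]
  have XY: "has_bochner_integral M (\<lambda>\<omega>. G $ a $ i * (X \<omega> $ a * (W t \<omega> - W s \<omega>) $ i)) (G $ a $ i * 0)" for a i
  proof -
    have "integrable M (\<lambda>\<omega>. (X \<omega> $ a)\<^sup>2)"
    proof (rule Bochner_Integration.integrable_bound[OF int])
      have "(X \<omega> $ a)\<^sup>2 \<le> (norm (X \<omega>))\<^sup>2" for \<omega>
        by (rule abs_le_square_iff[THEN iffD1]) (simp add: component_le_norm_cart)
      then show "AE \<omega> in M. norm ((X \<omega> $ a)\<^sup>2) \<le> norm ((norm (X \<omega>))\<^sup>2)" by simp
    qed measurable
    then have "integrable M (\<lambda>\<omega>. X \<omega> $ a)"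
      by (rule square_integrable_imp_integrable[rotated]) measurable
    moreover have "indep_var borel (\<lambda>\<omega>. X \<omega> $ a) borel (\<lambda>\<omega>. (W t \<omega> - W s \<omega>) $ i)"
      by (intro brownian_increment_indep measurable_compose[OF X nth])
    ultimately show ?thesis
      using brownian_increment_integrable(1) brownian_increment_expectation
      by (intro has_bochner_integral_mult_right)
         (simp add: has_bochner_integral_iff indep_var_integrable indep_var_lebesgue_integral)
  qed
  have "has_bochner_integral M
      (\<lambda>\<omega>. \<Sum>a\<in>UNIV. \<Sum>i\<in>UNIV. G $ a $ i * (X \<omega> $ a * (W t \<omega> - W s \<omega>) $ i))
      (\<Sum>a\<in>UNIV. \<Sum>i\<in>UNIV. G $ a $ i * 0)"
    by (intro has_bochner_integral_sum XY)
  also have "(\<lambda>\<omega>. \<Sum>a\<in>UNIV. \<Sum>i\<in>UNIV. G $ a $ i * (X \<omega> $ a * (W t \<omega> - W s \<omega>) $ i))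
      = (\<lambda>\<omega>. X \<omega> \<bullet> (G *v (W t \<omega> - W s \<omega>)))"
    by (simp add: inner_vec_def matrix_vector_mult_def sum_distrib_left mult_ac)
  finally show ?thesis by simp
qed

end

section \<open>The implicit Euler scheme and its second moments\<close>

text \<open>The inverse in the definition is a genuine inverse only where the resolvent map is bijective,
  which \<open>surj_resolvent\<close> and \<open>norm_le_resolvent_diff\<close> provide.\<close>

primrec implicit_euler :: "(real \<Rightarrow> 'a \<Rightarrow> 'a) \<Rightarrow> real \<Rightarrow> 'a \<Rightarrow> (real \<Rightarrow> 'a) \<Rightarrow> nat \<Rightarrow> 'a::real_vector" where
  "implicit_euler b D init g 0 = init"
| "implicit_euler b D init g (Suc i) =
     inv (\<lambda>x. x - D *\<^sub>R b (real (Suc i) * D) x)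
       (implicit_euler b D init g i + (g (real (Suc i) * D) - g (real i * D)))"

lemma implicit_euler_step:
  fixes b :: "real \<Rightarrow> 'a::euclidean_space \<Rightarrow> 'a"
  assumes "\<And>s. continuous_on UNIV (b s)"
    and "\<And>s x y. (b s x - b s y) \<bullet> (x - y) \<le> 0" and "0 \<le> D"
  shows "implicit_euler b D init g (Suc i) - D *\<^sub>R b (real (Suc i) * D) (implicit_euler b D init g (Suc i))
     = implicit_euler b D init g i + (g (real (Suc i) * D) - g (real i * D))"
  using surj_f_inv_f[OF surj_resolvent[OF assms]] by simp

text \<open>The inverse is 1-Lipschitz by \<open>norm_le_resolvent_diff\<close>, hence continuous.
  This keeps the scheme adapted.\<close>

lemma borel_measurable_resolvent_inverse:
  fixes B :: "'a::euclidean_space \<Rightarrow> 'a"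
  assumes cont: "continuous_on UNIV B"
    and diss: "\<And>x y. (B x - B y) \<bullet> (x - y) \<le> 0" and D: "0 \<le> D"
  shows "inv (\<lambda>x. x - D *\<^sub>R B x) \<in> borel_measurable borel"
proof -
  let ?J = "inv (\<lambda>x. x - D *\<^sub>R B x)"
  have J: "?J y - D *\<^sub>R B (?J y) = y" for y
    using surj_f_inv_f[OF surj_resolvent[OF assms]] .
  have "1-lipschitz_on UNIV ?J"
  proof (rule lipschitz_onI)
    fix x y
    show "dist (?J x) (?J y) \<le> 1 * dist x y"
      using norm_le_resolvent_diff[where B = B and x = "?J x" and y = "?J y", OF diss D] unfolding J dist_norm by simp
  qed simp
  then show ?thesis
    by (intro borel_measurable_continuous_onI lipschitz_on_continuous_on)
qed

text \<open>Adaptedness and square integrability at step \<open>i\<close> are what orthogonality of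
  state and increment requires, so they are carried through one induction, whose step also yields
  the recursion.\<close>

lemma implicit_euler_moments:
  fixes M :: "'w measure" and F :: "real \<Rightarrow> 'w measure" and W :: "real \<Rightarrow> 'w \<Rightarrow> real^'k"
    and b :: "real \<Rightarrow> real^'n \<Rightarrow> real^'n" and G :: "real^'k^'n" and init :: "real^'n"
  assumes filt: "filtered_prob_space M F" and bm: "std_brownian_motion M F W"
    and cont: "\<And>s. continuous_on UNIV (b s)"
    and diss: "\<And>s x y. (b s x - b s y) \<bullet> (x - y) \<le> 0"
    and coercive: "\<And>s x. 2 * (b s x \<bullet> x) \<le> - \<kappa> * (norm x)\<^sup>2"
    and "0 < \<kappa>" and D: "0 < D"
  defines "X \<equiv> \<lambda>i \<omega>. implicit_euler b D init (\<lambda>t. G *v (W t \<omega> - W 0 \<omega>)) i"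
  shows "X i \<in> borel_measurable (F (real i * D))" (is "?meas i")
    and "integrable M (\<lambda>\<omega>. (norm (X i \<omega>))\<^sup>2)" (is "?int i")
    and "(1 + \<kappa> * D) * integral\<^sup>L M (\<lambda>\<omega>. (norm (X (Suc i) \<omega>))\<^sup>2)
       \<le> integral\<^sup>L M (\<lambda>\<omega>. (norm (X i \<omega>))\<^sup>2) + trace (G ** transpose G) * D" (is "?rec i")
proof -
  interpret prob_space M using filt by (simp add: filtered_prob_space_def)
  have sub: "subalgebra M (F t)" for t using filt by (simp add: filtered_prob_space_def)
  have mono: "subalgebra (F t) (F s)" if "s \<le> t" for s t
    using filt that filtration.sets_F_mono filtration.space_F
    unfolding filtered_prob_space_def subalgebra_def by metis
  have Wm: "W t \<in> borel_measurable (F t)" if "0 \<le> t" for t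
    using bm that by (simp add: std_brownian_motion_def)
  define q where "q = 1 + \<kappa> * D"
  have q: "1 < q" using \<open>0 < \<kappa>\<close> D by (simp add: q_def)
  have step: "?meas (Suc i) \<and> ?int (Suc i) \<and> ?rec i" if IH: "?meas i" "?int i" for i
  proof -
    define s t where "s = real i * D" and "t = real (Suc i) * D"
    have st: "0 \<le> s" "s < t" "t - s = D" using D by (auto simp: s_def t_def algebra_simps)
    define \<xi> where "\<xi> \<omega> = G *v (W t \<omega> - W s \<omega>)" for \<omega>
    let ?J = "inv (\<lambda>x. x - D *\<^sub>R b t x)"
    \<comment> \<open>\<open>W 0\<close> cancels between the two forcing values, leaving the
      increment from \<open>s\<close> to \<open>t\<close>.\<close>
    have XSuc: "X (Suc i) = (\<lambda>\<omega>. ?J (X i \<omega> + \<xi> \<omega>))"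
      by (simp add: X_def \<xi>_def s_def t_def fun_eq_iff matrix_vector_mult_diff_distrib)
    have mX: "X i \<in> borel_measurable (F t)"
      using measurable_from_subalg[OF mono IH(1)[folded s_def]] st by simp
    have mW: "(\<lambda>\<omega>. W t \<omega> - W s \<omega>) \<in> borel_measurable (F t)"
      using measurable_from_subalg[OF mono Wm[of s]] Wm[of t] st
      by (intro borel_measurable_diff) auto
    have "(\<lambda>x. G *v x) \<in> borel_measurable borel"
      by (intro borel_measurable_continuous_onI linear_continuous_on matrix_vector_mul_bounded_linear)
    then have m\<xi>: "\<xi> \<in> borel_measurable (F t)"
      using measurable_compose[OF mW] unfolding \<xi>_def by blast
    have meas: "X (Suc i) \<in> borel_measurable (F t)"
      unfolding XSuc using D
      by (intro measurable_compose[OF borel_measurable_add[OF mX m\<xi>]]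
          borel_measurable_resolvent_inverse cont diss) simp
    then have mM: "X (Suc i) \<in> borel_measurable M"
      using sub measurable_from_subalg by blast
    \<comment> \<open>The cross term has mean zero because \<open>X i\<close> is measurable with
      respect to \<open>F s\<close>, the time at which the increment starts.\<close>
    have "has_bochner_integral M (\<lambda>\<omega>. (norm (X i \<omega>))\<^sup>2 + 2 * (X i \<omega> \<bullet> \<xi> \<omega>) + (norm (\<xi> \<omega>))\<^sup>2)
      (integral\<^sup>L M (\<lambda>\<omega>. (norm (X i \<omega>))\<^sup>2) + 2 * 0 + (t - s) * trace (G ** transpose G))"
      unfolding \<xi>_def using IH st
      by (intro has_bochner_integral_add has_bochner_integral_mult_right
          brownian_increment_orthogonal[OF filt bm] brownian_increment_matrix_norm_sq[OF filt bm])
         (auto simp: s_def has_bochner_integral_iff)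
    also have "(\<lambda>\<omega>. (norm (X i \<omega>))\<^sup>2 + 2 * (X i \<omega> \<bullet> \<xi> \<omega>) + (norm (\<xi> \<omega>))\<^sup>2) = (\<lambda>\<omega>. (norm (X i \<omega> + \<xi> \<omega>))\<^sup>2)"
      by (simp add: power2_norm_eq_inner inner_add inner_commute[of "\<xi> _" "X i _"] fun_eq_iff)
    finally have sum: "integrable M (\<lambda>\<omega>. (norm (X i \<omega> + \<xi> \<omega>))\<^sup>2)"
      "integral\<^sup>L M (\<lambda>\<omega>. (norm (X i \<omega> + \<xi> \<omega>))\<^sup>2)
         = integral\<^sup>L M (\<lambda>\<omega>. (norm (X i \<omega>))\<^sup>2) + trace (G ** transpose G) * D"
      using st(3) by (simp_all add: has_bochner_integral_iff mult.commute)
    \<comment> \<open>The resolvent estimate applies for every \<open>\<omega>\<close>, at the new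
      state. Since \<open>q > 1\<close>, it also provides the dominating function for integrability
      below.\<close>
    have le: "q * (norm (X (Suc i) \<omega>))\<^sup>2 \<le> (norm (X i \<omega> + \<xi> \<omega>))\<^sup>2" for \<omega>
    proof -
      have surj: "surj (\<lambda>x. x - D *\<^sub>R b t x)"
        using D by (intro surj_resolvent cont diss) simp
      have "X (Suc i) \<omega> - D *\<^sub>R b t (X (Suc i) \<omega>) = X i \<omega> + \<xi> \<omega>"
        unfolding XSuc by (rule surj_f_inv_f[OF surj])
      then show ?thesis
        using resolvent_norm_sq_le[where B = "b t" and x = "X (Suc i) \<omega>", OF coercive] D
        unfolding q_def by (metis less_imp_le)
    qed
    have int: "?int (Suc i)"
    proof (rule Bochner_Integration.integrable_bound[OF sum(1)])
      show "(\<lambda>\<omega>. (norm (X (Suc i) \<omega>))\<^sup>2) \<in> borel_measurable M"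
        using mM by measurable
      have "(norm (X (Suc i) \<omega>))\<^sup>2 \<le> (norm (X i \<omega> + \<xi> \<omega>))\<^sup>2" for \<omega>
        using le[of \<omega>] mult_right_mono[OF less_imp_le[OF q] zero_le_power2[of "norm (X (Suc i) \<omega>)"]]
        by linarith
      then show "AE \<omega> in M. norm ((norm (X (Suc i) \<omega>))\<^sup>2) \<le> norm ((norm (X i \<omega> + \<xi> \<omega>))\<^sup>2)"
        by simp
    qed
    have "integral\<^sup>L M (\<lambda>\<omega>. q * (norm (X (Suc i) \<omega>))\<^sup>2) \<le> integral\<^sup>L M (\<lambda>\<omega>. (norm (X i \<omega> + \<xi> \<omega>))\<^sup>2)"
      using int sum(1) le by (intro integral_mono) auto
    then show ?thesis
      using int meas sum(2) by (simp add: q_def t_def)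
  qed
  have "?meas i \<and> ?int i"
  proof (induction i)
    case 0
    have "X 0 = (\<lambda>_. init)" by (simp add: X_def fun_eq_iff)
    then show ?case by simp
  next
    case (Suc i)
    then show ?case using step by blast
  qed
  then show "?meas i" "?int i" "?rec i" using step by blast+
qed

section \<open>Passage to the limit in mean square\<close>

text \<open>Fatou's lemma transfers the moment bounds of the scheme to the solution. It gives
  integrability together with the estimate, so no a priori moment of \<open>w\<close>
  enters.\<close>

lemma dissipative_sde_mean_square_bound:
  fixes M :: "'w measure" and F :: "real \<Rightarrow> 'w measure" and W :: "real \<Rightarrow> 'w \<Rightarrow> real^'k"
    and b :: "real \<Rightarrow> real^'n \<Rightarrow> real^'n" and G :: "real^'k^'n" and w :: "real \<Rightarrow> 'w \<Rightarrow> real^'n"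
  assumes filt: "filtered_prob_space M F" and bm: "std_brownian_motion M F W"
    and cont: "\<And>s. continuous_on UNIV (b s)"
    and diss: "\<And>s x y. 2 * ((b s x - b s y) \<bullet> (x - y)) \<le> - \<kappa> * (norm (x - y))\<^sup>2"
    and b0: "\<And>s. b s 0 = 0"
    and \<kappa>: "0 < \<kappa>" and T: "0 < T"
    and wm: "w T \<in> borel_measurable M"
    and wcont: "AE \<omega> in M. continuous_on {0..T} (\<lambda>s. b s (w s \<omega>))"
    and w: "AE \<omega> in M. \<forall>t\<in>{0..T}.
       w t \<omega> = w0 + integral {0..t} (\<lambda>s. b s (w s \<omega>)) + G *v (W t \<omega> - W 0 \<omega>)"
  shows "integrable M (\<lambda>\<omega>. (norm (w T \<omega>))\<^sup>2)"
    and "integral\<^sup>L M (\<lambda>\<omega>. (norm (w T \<omega>))\<^sup>2)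
       \<le> exp (- \<kappa> * T) * (norm w0)\<^sup>2 + trace (G ** transpose G) / \<kappa> * (1 - exp (- \<kappa> * T))"
proof -
  interpret prob_space M using filt by (simp add: filtered_prob_space_def)
  have diss': "(b s x - b s y) \<bullet> (x - y) \<le> 0" for s x y
    using diss[of s x y] \<kappa> by (smt (verit) mult_nonneg_nonneg zero_le_power2 minus_mult_left)
  have coercive: "2 * (b s x \<bullet> x) \<le> - \<kappa> * (norm x)\<^sup>2" for s x
    using diss[of s x 0] by (simp add: b0)
  define X where "X n \<omega> = implicit_euler b (T / real n) w0 (\<lambda>t. G *v (W t \<omega> - W 0 \<omega>))" for n :: nat and \<omega>
  let ?S = "trace (G ** transpose G)"
  \<comment> \<open>This is the bound of \<open>affine_recursion_le\<close> after \<open>n\<close>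
    steps of length \<open>T / n\<close> from the deterministic start \<open>w0\<close>. It tends to
    \<open>B\<close> because \<open>(1 + \<kappa> * T / n) ^ n\<close> tends to
    \<open>exp (\<kappa> * T)\<close>.\<close>
  define Bn where "Bn n = ((norm w0)\<^sup>2 - ?S / \<kappa>) / (1 + \<kappa> * (T / real n)) ^ n + ?S / \<kappa>" for n :: nat
  define B where "B = exp (- \<kappa> * T) * (norm w0)\<^sup>2 + ?S / \<kappa> * (1 - exp (- \<kappa> * T))"

  have Xlim: "AE \<omega> in M. (\<lambda>n. X n \<omega> n) \<longlonglongrightarrow> w T \<omega>"
    using wcont w
  proof eventually_elim
    case (elim \<omega>)
    show ?case
    proof (rule implicit_euler_tendsto[where b = b and T = T and w = "\<lambda>t. w t \<omega>" and init = w0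
          and x = "\<lambda>n. X n \<omega>"
          and G = "\<lambda>t. G *v (W t \<omega> - W 0 \<omega>)"])
      fix n i
      show "X n \<omega> (Suc i) - (T / real n) *\<^sub>R b (real (Suc i) * (T / real n)) (X n \<omega> (Suc i))
        = X n \<omega> i + (G *v (W (real (Suc i) * (T / real n)) \<omega> - W 0 \<omega>)
            - G *v (W (real i * (T / real n)) \<omega> - W 0 \<omega>))"
        unfolding X_def using T by (intro implicit_euler_step cont diss') simp
    qed (use elim T diss' in \<open>auto simp: X_def\<close>)
  qed
  have Xm: "(\<lambda>\<omega>. X n \<omega> n) \<in> borel_measurable M"
    and Xint: "integrable M (\<lambda>\<omega>. (norm (X n \<omega> n))\<^sup>2)"
    and XB: "integral\<^sup>L M (\<lambda>\<omega>. (norm (X n \<omega> n))\<^sup>2) \<le> Bn n" if "0 < n" for n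
  proof -
    have D: "0 < T / real n" using T that by simp
    note mom = implicit_euler_moments[where b = b and G = G and init = w0, OF filt bm cont diss' coercive \<kappa> D]
    show "(\<lambda>\<omega>. X n \<omega> n) \<in> borel_measurable M"
      using mom(1)[of n] filt measurable_from_subalg
      unfolding X_def filtered_prob_space_def by blast
    show "integrable M (\<lambda>\<omega>. (norm (X n \<omega> n))\<^sup>2)"
      using mom(2)[of n] unfolding X_def .
    have "integral\<^sup>L M (\<lambda>\<omega>. (norm (X n \<omega> n))\<^sup>2)
      \<le> (integral\<^sup>L M (\<lambda>\<omega>. (norm (X n \<omega> 0))\<^sup>2) - ?S / \<kappa>) / (1 + \<kappa> * (T / real n)) ^ n + ?S / \<kappa>"
      using mom(3) D unfolding X_def by (intro affine_recursion_le \<kappa>) auto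
    then show "integral\<^sup>L M (\<lambda>\<omega>. (norm (X n \<omega> n))\<^sup>2) \<le> Bn n"
      by (simp add: X_def Bn_def prob_space)
  qed
  have "Bn \<longlonglongrightarrow> ((norm w0)\<^sup>2 - ?S / \<kappa>) / exp (\<kappa> * T) + ?S / \<kappa>"
    unfolding Bn_def times_divide_eq_right
    by (intro tendsto_intros tendsto_exp_limit_sequentially) simp
  also have "((norm w0)\<^sup>2 - ?S / \<kappa>) / exp (\<kappa> * T) + ?S / \<kappa> = B"
    by (simp add: B_def exp_minus divide_inverse algebra_simps)
  finally have BnB: "Bn \<longlonglongrightarrow> B" .
  \<comment> \<open>\<open>ennreal\<close> sends negative numbers to 0, so the return to a real
    bound requires \<open>0 \<le> B\<close>; the limit inherits this from the nonnegative second
    moments.\<close>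
  have "0 \<le> Bn n" if "0 < n" for n
    using XB[OF that] by (rule order_trans[rotated]) simp
  then have B0: "0 \<le> B"
    using BnB by (intro LIMSEQ_le_const[OF BnB]) (auto intro!: exI[of _ 1])

  \<comment> \<open>The index \<open>Suc n\<close> keeps the number of steps positive, as the moment
    bounds require. The limit is rewritten as a \<open>liminf\<close> to fit Fatou's lemma.\<close>
  have "(\<integral>\<^sup>+\<omega>. ennreal ((norm (w T \<omega>))\<^sup>2) \<partial>M)
      = (\<integral>\<^sup>+\<omega>. liminf (\<lambda>n. ennreal ((norm (X (Suc n) \<omega> (Suc n)))\<^sup>2)) \<partial>M)"
  proof (rule nn_integral_cong_AE)
    show "AE \<omega> in M. ennreal ((norm (w T \<omega>))\<^sup>2) = liminf (\<lambda>n. ennreal ((norm (X (Suc n) \<omega> (Suc n)))\<^sup>2))"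
      using Xlim
    proof eventually_elim
      case (elim \<omega>)
      then have "(\<lambda>n. ennreal ((norm (X (Suc n) \<omega> (Suc n)))\<^sup>2)) \<longlonglongrightarrow> ennreal ((norm (w T \<omega>))\<^sup>2)"
        by (intro tendsto_ennrealI tendsto_intros LIMSEQ_Suc[of "\<lambda>n. X n \<omega> n"])
      then show ?case
        using lim_imp_Liminf[OF sequentially_bot] by metis
    qed
  qed
  also have "\<dots> \<le> liminf (\<lambda>n. \<integral>\<^sup>+\<omega>. ennreal ((norm (X (Suc n) \<omega> (Suc n)))\<^sup>2) \<partial>M)"
  proof -
    have [measurable]: "(\<lambda>\<omega>. X (Suc n) \<omega> (Suc n)) \<in> borel_measurable M" for n
      using Xm[OF zero_less_Suc] .
    show ?thesis by (intro nn_integral_liminf) measurable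
  qed
  also have "\<dots> \<le> liminf (\<lambda>n. ennreal (Bn (Suc n)))"
    by (intro Liminf_mono always_eventually allI)
       (simp add: nn_integral_eq_integral Xint XB ennreal_leI)
  also have "\<dots> = ennreal B"
    using BnB by (intro lim_imp_Liminf sequentially_bot tendsto_ennrealI LIMSEQ_Suc)
  finally have fin: "(\<integral>\<^sup>+\<omega>. ennreal ((norm (w T \<omega>))\<^sup>2) \<partial>M) \<le> ennreal B" .
  show "integrable M (\<lambda>\<omega>. (norm (w T \<omega>))\<^sup>2)"
    using fin wm by (intro integrableI_bounded) (auto intro: le_less_trans)
  show "integral\<^sup>L M (\<lambda>\<omega>. (norm (w T \<omega>))\<^sup>2)
       \<le> exp (- \<kappa> * T) * (norm w0)\<^sup>2 + ?S / \<kappa> * (1 - exp (- \<kappa> * T))"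
    unfolding B_def[symmetric] using B0 fin by (rule integral_real_bounded)
qed

section \<open>Coercivity of the nudging term and the reference solution\<close>

lemma V_norm_sq:
  assumes "sym_pos_def A"
  shows "(V_norm A z)\<^sup>2 = z \<bullet> (A *v z)"
proof -
  have "0 \<le> z \<bullet> (A *v z)"
    using assms by (cases "z = 0") (auto simp: sym_pos_def_def less_imp_le)
  then show ?thesis by (simp add: V_norm_def)
qed

text \<open>Write \<open>J z\<close> as \<open>z - (z - J z)\<close>. Young's inequality costs half
  of \<open>\<mu> * (norm z)\<^sup>2\<close> and half of
  \<open>\<mu> * (norm (z - J z))\<^sup>2\<close>; the latter is absorbed by half of the viscous
  term because \<open>\<mu> * c0\<^sup>2 * h\<^sup>2 < \<nu>\<close>.\<close>

lemma nudging_coercive: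
  fixes A :: "real^'n^'n" and J :: "real^'n \<Rightarrow> real^'n"
  assumes A: "sym_pos_def A" and J: "norm (z - J z) \<le> c0 * h * V_norm A z"
    and "0 < \<mu>" and \<mu>: "\<mu> * c0\<^sup>2 * h\<^sup>2 < \<nu>"
  shows "\<mu> * (norm z)\<^sup>2 \<le> 2 * (\<nu> * (z \<bullet> (A *v z)) + \<mu> * (J z \<bullet> z))"
proof -
  have "2 * ((z - J z) \<bullet> z) \<le> (norm z)\<^sup>2 + (norm (z - J z))\<^sup>2"
  proof -
    have "2 * ((z - J z) \<bullet> z) \<le> 2 * (norm (z - J z) * norm z)"
      using norm_cauchy_schwarz[of "z - J z" z] by simp
    also have "\<dots> \<le> (norm z)\<^sup>2 + (norm (z - J z))\<^sup>2"
      using sum_squares_bound[of "norm z" "norm (z - J z)"] by (simp add: mult_ac)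
    finally show ?thesis .
  qed
  also have "(norm (z - J z))\<^sup>2 \<le> c0\<^sup>2 * h\<^sup>2 * (z \<bullet> (A *v z))"
    using power_mono[OF J norm_ge_zero, of 2] by (simp add: power_mult_distrib V_norm_sq[OF A])
  finally have "\<mu> * (2 * ((z - J z) \<bullet> z)) \<le> \<mu> * ((norm z)\<^sup>2 + c0\<^sup>2 * h\<^sup>2 * (z \<bullet> (A *v z)))"
    using \<open>0 < \<mu>\<close> by (intro mult_left_mono) auto
  moreover have "\<mu> * c0\<^sup>2 * h\<^sup>2 * (z \<bullet> (A *v z)) \<le> \<nu> * (z \<bullet> (A *v z))"
    using \<mu> V_norm_sq[OF A, of z] by (intro mult_right_mono) (auto simp: less_imp_le simp flip: V_norm_sq[OF A])
  \<comment> \<open>The remaining half of the viscous term is dropped; the sign of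
    \<open>\<nu>\<close> follows from
    \<open>0 \<le> \<mu> * c0\<^sup>2 * h\<^sup>2 < \<nu>\<close>.\<close>
  moreover have "0 \<le> \<nu> * (z \<bullet> (A *v z))"
  proof -
    have "0 \<le> \<mu> * c0\<^sup>2 * h\<^sup>2" using \<open>0 < \<mu>\<close> by simp
    then show ?thesis using \<mu> V_norm_sq[OF A, of z] by (metis less_imp_le order_trans mult_nonneg_nonneg zero_le_power2)
  qed
  ultimately show ?thesis
    by (simp add: inner_diff_left power2_norm_eq_inner algebra_simps)
qed

lemma local_lipschitz_time_independent_continuous:
  fixes N :: "'a::metric_space \<Rightarrow> 'b::metric_space"
  assumes "local_lipschitz (UNIV :: real set) UNIV (\<lambda>_. N)"
  shows "continuous_on UNIV N"
  using local_lipschitz_continuous_on[OF assms, of 0] by simp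

lemma global_solution_continuous_on:
  assumes "global_solution \<nu> A N f u0 u"
  shows "continuous_on {0..} u"
  using assms unfolding global_solution_def continuous_on_eq_continuous_within
  by (auto intro: has_vector_derivative_continuous)

lemma global_solution_integral:
  assumes u: "global_solution \<nu> A N f u0 u" and "0 \<le> t"
  shows "((\<lambda>s. f - \<nu> *\<^sub>R (A *v u s) - N (u s)) has_integral (u t - u0)) {0..t}"
proof -
  have "((\<lambda>s. f - \<nu> *\<^sub>R (A *v u s) - N (u s)) has_integral (u t - u 0)) {0..t}"
  proof (rule fundamental_theorem_of_calculus[OF \<open>0 \<le> t\<close>])
    fix s assume "s \<in> {0..t}"
    then show "(u has_vector_derivative f - \<nu> *\<^sub>R (A *v u s) - N (u s)) (at s within {0..t})"
      using u unfolding global_solution_def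
      by (auto intro: has_vector_derivative_within_subset[where S = "{0..}"])
  qed
  then show ?thesis using u by (simp add: global_solution_def)
qed

lemma trace_scaleR_mult_transpose:
  fixes G :: "real^'k^'n"
  shows "trace ((c *\<^sub>R G) ** transpose (c *\<^sub>R G)) = c\<^sup>2 * trace (G ** transpose G)"
  by (simp add: trace_def matrix_matrix_mult_def transpose_def sum_distrib_left power2_eq_square mult_ac)

section \<open>The difference between the nudged and the reference solution\<close>

theorem theorem2p18:
  fixes A :: "real^'d^'d" and N :: "real^'d \<Rightarrow> real^'d" and f u0 v0 :: "real^'d"
    and I :: "real \<Rightarrow> real^'d \<Rightarrow> real^'d"
    and Oh :: "real^'d \<Rightarrow> real^'k" and Rh :: "real^'k \<Rightarrow> real^'d"
    and \<Sigma> :: "real^'k^'k" and \<Gamma> :: "real^'k^'d"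
    and M :: "'w measure" and F :: "real \<Rightarrow> 'w measure" and W :: "real \<Rightarrow> 'w \<Rightarrow> real^'k"
    and u :: "real \<Rightarrow> real^'d" and v :: "real \<Rightarrow> 'w \<Rightarrow> real^'d"
    and \<nu> lam1 \<alpha> \<beta> CE c0 h \<mu> Cgl :: real
  assumes "\<nu> > 0"
    and "linear_dissipation A lam1"
    and "H_dissipativity \<nu> A N \<alpha> \<beta>"
    and "nonlinearity_assumption N CE"
    and "feedback_operator A I c0"
    and "h \<in> {0..1}"
    and "linear Oh" and "linear Rh" and "I h = Rh \<circ> Oh"
    and "\<Gamma> = matrix Rh ** \<Sigma>"
    and "filtered_prob_space M F"
    and "std_brownian_motion M F W"
    and "\<mu> > 0" and "\<mu> * c0\<^sup>2 * h\<^sup>2 < \<nu>"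
    and "\<nu> * lam1 / 2 + \<mu> / 2 - CE > 0"
    and "Cgl \<ge> 0"
    and "\<forall>z z'. - ((N z' - N z) \<bullet> (z' - z)) \<le> Cgl * (norm (z' - z))\<^sup>2"
    and "\<mu> > 2 * Cgl"
    and "global_solution \<nu> A N f u0 u"
    and "strong_solution M F W \<nu> A N f \<mu> (I h) \<Gamma> u v0 v"
  shows "(\<forall>t\<ge>0. integrable M (\<lambda>\<omega>. (norm (v t \<omega> - u t))\<^sup>2) \<and>
            prob_space.expectation M (\<lambda>\<omega>. (norm (v t \<omega> - u t))\<^sup>2)
              \<le> exp (- (\<mu> - 2 * Cgl) * t) * (norm (v0 - u0))\<^sup>2
                + \<mu>\<^sup>2 * trace (\<Gamma> ** transpose \<Gamma>) / (\<mu> - 2 * Cgl) * (1 - exp (- (\<mu> - 2 * Cgl) * t)))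
         \<and> Limsup at_top (\<lambda>t. ereal (prob_space.expectation M (\<lambda>\<omega>. (norm (v t \<omega> - u t))\<^sup>2)))
              \<le> ereal (\<mu>\<^sup>2 * trace (\<Gamma> ** transpose \<Gamma>) / (\<mu> - 2 * Cgl))"
proof -
  interpret prob_space M using assms(11) by (simp add: filtered_prob_space_def)
  define \<kappa> where "\<kappa> = \<mu> - 2 * Cgl"
  have \<kappa>: "0 < \<kappa>" using assms by (simp add: \<kappa>_def)
  have A: "sym_pos_def A" using assms(2) by (simp add: linear_dissipation_def)
  have Ih: "linear (I h)" and Ih_le: "norm (z - I h z) \<le> c0 * h * V_norm A z" for z
    using assms(5,6) by (auto simp: feedback_operator_def)
  have N: "continuous_on UNIV N"
    using assms(4) local_lipschitz_time_independent_continuous by (auto simp: nonlinearity_assumption_def)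
  have N_cont [continuous_intros]: "continuous_on S (\<lambda>x. N (g x))" if "continuous_on S g"
    for S and g :: "'z::topological_space \<Rightarrow> real^'d"
    using continuous_on_compose2[OF N that] by simp
  have I_cont [continuous_intros]: "continuous_on S (\<lambda>x. I h (g x))" if "continuous_on S g"
    for S and g :: "'z::topological_space \<Rightarrow> real^'d"
    using continuous_on_compose2[OF linear_continuous_on[OF linear_conv_bounded_linear[THEN iffD1, OF Ih]] that] by blast
  have A_cont [continuous_intros]: "continuous_on S (\<lambda>x. A *v g x)" if "continuous_on S g"
    for S and g :: "'z::topological_space \<Rightarrow> real^'d"
    using continuous_on_compose2[OF linear_continuous_on[OF matrix_vector_mul_bounded_linear] that] by blast

  \<comment> \<open>The drift of \<open>v - u\<close>: the forcing \<open>f\<close> cancels,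
    linearity merges the feedback terms, and \<open>u\<close> survives only as the base point of the
    increment of \<open>N\<close>.\<close>
  define b where "b s x = - (\<nu> *\<^sub>R (A *v x)) - (N (u s + x) - N (u s)) - \<mu> *\<^sub>R I h x" for s x
  have b_cont: "continuous_on UNIV (b s)" for s
    unfolding b_def by (intro continuous_intros)
  have b0: "b s 0 = 0" for s
    using linear_0[OF Ih] by (simp add: b_def)
  \<comment> \<open>Nudging and viscosity together contribute \<open>- \<mu>\<close>, and the global
    one-sided bound on \<open>N\<close>, taken at \<open>u s + x\<close> and \<open>u s + y\<close>,
    contributes at most \<open>2 * Cgl\<close>. The sum is \<open>- \<kappa>\<close>.\<close>
  have b_diss: "2 * ((b s x - b s y) \<bullet> (x - y)) \<le> - \<kappa> * (norm (x - y))\<^sup>2" for s x y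
  proof -
    define z where "z = x - y"
    have "b s x - b s y = - (\<nu> *\<^sub>R (A *v z)) - (N (u s + x) - N (u s + y)) - \<mu> *\<^sub>R I h z"
      by (simp add: b_def z_def linear_diff[OF Ih] matrix_vector_mult_diff_distrib algebra_simps)
    then have "(b s x - b s y) \<bullet> z
      = - (\<nu> * (z \<bullet> (A *v z))) - (N (u s + x) - N (u s + y)) \<bullet> z - \<mu> * (I h z \<bullet> z)"
      by (simp add: inner_diff_left inner_commute[of z "A *v z"])
    moreover have "- ((N (u s + x) - N (u s + y)) \<bullet> z) \<le> Cgl * (norm z)\<^sup>2"
      using assms(17)[rule_format, of "u s + x" "u s + y"] by (simp add: z_def)
    moreover have "\<mu> * (norm z)\<^sup>2 \<le> 2 * (\<nu> * (z \<bullet> (A *v z)) + \<mu> * (I h z \<bullet> z))"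
      using nudging_coercive[where J = "I h", OF A Ih_le assms(13,14)] .
    ultimately show ?thesis
      unfolding z_def[symmetric] \<kappa>_def by (simp add: algebra_simps)
  qed

  define w where "w t \<omega> = v t \<omega> - u t" for t \<omega>
  let ?G = "\<mu> *\<^sub>R \<Gamma>"
  define S where "S = trace (?G ** transpose ?G)"
  have u_cont: "continuous_on {0..} u"
    using assms(19) by (rule global_solution_continuous_on)
  have v_meas: "v t \<in> borel_measurable M" if "0 \<le> t" for t
    using assms(20,11) that measurable_from_subalg
    unfolding strong_solution_def filtered_prob_space_def by blast
  have v_cont: "AE \<omega> in M. continuous_on {0..} (\<lambda>t. v t \<omega>)"
    using assms(20) by (simp add: strong_solution_def)
  have w_cont: "AE \<omega> in M. continuous_on {0..} (\<lambda>s. b s (w s \<omega>))"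
    using v_cont
  proof eventually_elim
    case (elim \<omega>)
    show ?case
      unfolding b_def w_def using elim u_cont by (intro continuous_intros)
  qed
  have w_eq: "AE \<omega> in M. \<forall>t\<ge>0.
      w t \<omega> = (v0 - u0) + integral {0..t} (\<lambda>s. b s (w s \<omega>)) + ?G *v (W t \<omega> - W 0 \<omega>)"
  proof -
    have "AE \<omega> in M. \<forall>t\<ge>0. v t \<omega> = v0
        + integral {0..t} (\<lambda>s. f - \<nu> *\<^sub>R (A *v v s \<omega>) - N (v s \<omega>) - \<mu> *\<^sub>R (I h (v s \<omega>) - I h (u s)))
        + ?G *v (W t \<omega> - W 0 \<omega>)"
      using assms(20) by (simp add: strong_solution_def ito_integral_const_def)
    then show ?thesis
      using w_cont
    proof eventually_elim
      case (elim \<omega>)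
      show ?case
      proof (intro allI impI)
        fix t :: real assume t: "0 \<le> t"
        have "continuous_on {0..t} (\<lambda>s. b s (w s \<omega>))"
          by (rule continuous_on_subset[OF elim(2)]) auto
        then have "((\<lambda>s. b s (w s \<omega>)) has_integral integral {0..t} (\<lambda>s. b s (w s \<omega>))) {0..t}"
          by (intro integrable_integral integrable_continuous_interval)
        \<comment> \<open>The drift of \<open>v\<close> is \<open>b s (w s \<omega>)\<close> plus
          the drift of \<open>u\<close>. Adding two integrals known to exist gives the integral of
          the former without a separate integrability argument.\<close>
        from has_integral_add[OF this global_solution_integral[OF assms(19) t]]
        have "((\<lambda>s. f - \<nu> *\<^sub>R (A *v v s \<omega>) - N (v s \<omega>) - \<mu> *\<^sub>R (I h (v s \<omega>) - I h (u s)))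
            has_integral (integral {0..t} (\<lambda>s. b s (w s \<omega>)) + (u t - u0))) {0..t}"
          by (rule has_integral_eq[rotated])
             (simp add: b_def w_def linear_diff[OF Ih] matrix_vector_mult_diff_distrib algebra_simps)
        then show "w t \<omega> = (v0 - u0) + integral {0..t} (\<lambda>s. b s (w s \<omega>)) + ?G *v (W t \<omega> - W 0 \<omega>)"
          using elim(1)[rule_format, OF t] by (simp add: w_def integral_unique)
      qed
    qed
  qed

  define B where "B t = exp (- \<kappa> * t) * (norm (v0 - u0))\<^sup>2 + S / \<kappa> * (1 - exp (- \<kappa> * t))" for t
  have main: "integrable M (\<lambda>\<omega>. (norm (w t \<omega>))\<^sup>2) \<and> expectation (\<lambda>\<omega>. (norm (w t \<omega>))\<^sup>2) \<le> B t"
    if "0 \<le> t" for t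
  \<comment> \<open>The general bound needs a horizon of positive length. At time 0 the integral
    equation makes \<open>w\<close> almost surely equal to \<open>v0 - u0\<close>, and
    \<open>B 0\<close> is its squared norm.\<close>
  proof (cases "t = 0")
    case True
    have wm0: "w 0 \<in> borel_measurable M"
      using v_meas[of 0] unfolding w_def by simp
    have ae: "AE \<omega> in M. (norm (w 0 \<omega>))\<^sup>2 = (norm (v0 - u0))\<^sup>2"
      using w_eq by eventually_elim (drule spec[of _ 0], simp)
    have "has_bochner_integral M (\<lambda>\<omega>. (norm (w 0 \<omega>))\<^sup>2) ((norm (v0 - u0))\<^sup>2)
      \<longleftrightarrow> has_bochner_integral M (\<lambda>\<omega>. (norm (v0 - u0))\<^sup>2) ((norm (v0 - u0))\<^sup>2)"
      using ae wm0 by (intro has_bochner_integral_cong_AE) auto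
    then show ?thesis
      using True by (simp add: has_bochner_integral_iff B_def prob_space)
  next
    case False
    then have t: "0 < t" using that by simp
    have "w t \<in> borel_measurable M"
      using v_meas[OF that] unfolding w_def by simp
    moreover have "AE \<omega> in M. continuous_on {0..t} (\<lambda>s. b s (w s \<omega>))"
      using w_cont by eventually_elim (auto intro: continuous_on_subset)
    moreover have "AE \<omega> in M. \<forall>t'\<in>{0..t}.
        w t' \<omega> = (v0 - u0) + integral {0..t'} (\<lambda>s. b s (w s \<omega>)) + ?G *v (W t' \<omega> - W 0 \<omega>)"
      using w_eq by eventually_elim auto
    ultimately show ?thesis
      using dissipative_sde_mean_square_bound[where b = b and w = w and G = ?G,
          OF assms(11,12) b_cont b_diss b0 \<kappa> t]
      unfolding B_def S_def by blast
  qed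
  have "((\<lambda>t. exp (- \<kappa> * t)) \<longlongrightarrow> 0) at_top"
    using \<kappa> by real_asymp
  then have "(B \<longlongrightarrow> 0 * (norm (v0 - u0))\<^sup>2 + S / \<kappa> * (1 - 0)) at_top"
    unfolding B_def by (intro tendsto_intros)
  then have B_lim: "((\<lambda>t. ereal (B t)) \<longlongrightarrow> ereal (S / \<kappa>)) at_top"
    by simp
  have "Limsup at_top (\<lambda>t. ereal (expectation (\<lambda>\<omega>. (norm (w t \<omega>))\<^sup>2))) \<le> Limsup at_top (\<lambda>t. ereal (B t))"
    using main by (intro Limsup_mono eventually_at_top_linorderI[of 0]) simp
  also have "\<dots> = ereal (S / \<kappa>)"
    using B_lim by (intro lim_imp_Limsup) auto
  finally have "Limsup at_top (\<lambda>t. ereal (expectation (\<lambda>\<omega>. (norm (w t \<omega>))\<^sup>2))) \<le> ereal (S / \<kappa>)" .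
  \<comment> \<open>\<open>S\<close> belongs to the scaled noise matrix
    \<open>\<mu> *\<^sub>R \<Gamma>\<close>; this is where the factor \<open>\<mu>\<^sup>2\<close>
    comes from.\<close>
  moreover have "S = \<mu>\<^sup>2 * trace (\<Gamma> ** transpose \<Gamma>)"
    unfolding S_def by (rule trace_scaleR_mult_transpose)
  ultimately show ?thesis
    using main unfolding B_def w_def \<kappa>_def by simp
qed

end
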